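(* Let $l\in\mathbb{N}$ and let $I=\langle f_1,f_2,\dots,f_n\rangle$ be an ideal in $\mathbb{C}[x_1,x_2,\dots,x_l]$, where $m\le n$ of the $f_i$ are inhomogeneous and the rest are homogeneous. Let $f_i$ be one of the inhomogeneous polynomials and write $f_i=\sum_{j=1}^{n_i}h_{ij}$, where the $h_{ij}$ are the homogeneous components of $f_i$. If $I$ is homogeneous, then there exists some $h_{ij}$ ($1\le j\le n_i$) such that every monomial in that $h_{ij}$ is divisible either by at least one monomial of some $f_k$ ($k\ne i$) or by at least one monomial of some $h_{ik}$ ($k\in\{1,\dots,n_i\}\setminus\{j\}$).
   Context: Homogeneity is with respect to the standard grading ($\deg x_i=1$). An ideal is homogeneous if it can be generated by homogeneous polynomials. The homogeneous components $h_{ij}$ of $f_i$ are its nonzero graded pieces, of pairwise distinct degrees. A monomial of (or in) a polynomial is a monomial occurring in it with nonzero coefficient. *)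

theory Defs
  imports Complex_Main "HOL-Library.Poly_Mapping" "HOL-Algebra.Ideal" "HOL-Algebra.Divisibility"
begin

text \<open>An exponent vector is a finitely supported function \<^typ>\<open>nat \<Rightarrow>\<^sub>0 nat\<close>; a polynomial is a
  finitely supported function from exponent vectors to coefficients, with the convolution
  product of \<^theory>\<open>HOL-Library.Poly_Mapping\<close>.\<close>

type_synonym mpoly = "(nat \<Rightarrow>\<^sub>0 nat) \<Rightarrow>\<^sub>0 complex"

text \<open>The ring $\mathbb{C}[x_1,\dots,x_l]$: the subring of those polynomials all of whose
  exponent vectors are supported in \<open>{1..l}\<close>.\<close>

definition poly_ring :: "nat \<Rightarrow> mpoly ring" where
  "poly_ring l = \<lparr>carrier = {p. \<forall>s \<in> Poly_Mapping.keys p. Poly_Mapping.keys s \<subseteq> {1..l}},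
     monoid.mult = (*), one = 1, zero = 0, add = (+)\<rparr>"

definition total_deg :: "(nat \<Rightarrow>\<^sub>0 nat) \<Rightarrow> nat" where
  "total_deg s = (\<Sum>v \<in> Poly_Mapping.keys s. Poly_Mapping.lookup s v)"

text \<open>The monomials occurring in a polynomial, as monic one-term polynomials.\<close>

definition monomials :: "mpoly \<Rightarrow> mpoly set" where
  "monomials p = (\<lambda>s. Poly_Mapping.single s 1) ` Poly_Mapping.keys p"

definition homogeneous_of_deg :: "nat \<Rightarrow> mpoly \<Rightarrow> bool" where
  "homogeneous_of_deg d p \<longleftrightarrow> (\<forall>s \<in> Poly_Mapping.keys p. total_deg s = d)"

text \<open>The zero polynomial is homogeneous (of every degree).\<close>

definition homogeneous :: "mpoly \<Rightarrow> bool" where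
  "homogeneous p \<longleftrightarrow> (\<exists>d. homogeneous_of_deg d p)"

definition homogeneous_ideal :: "nat \<Rightarrow> mpoly set \<Rightarrow> bool" where
  "homogeneous_ideal l I \<longleftrightarrow>
     (\<exists>S \<subseteq> carrier (poly_ring l). (\<forall>p \<in> S. homogeneous p) \<and> I = Idl\<^bsub>poly_ring l\<^esub> S)"

text \<open>\<open>h 1, \<dots>, h N\<close> is an enumeration of the nonzero graded pieces of \<open>p\<close>; \<open>d j\<close> is the degree
  of \<open>h j\<close>.\<close>

definition homogeneous_components :: "mpoly \<Rightarrow> nat \<Rightarrow> (nat \<Rightarrow> mpoly) \<Rightarrow> bool" where
  "homogeneous_components p N h \<longleftrightarrow>
     p = (\<Sum>j = 1..N. h j) \<and>
     (\<exists>d. inj_on d {1..N} \<and> (\<forall>j \<in> {1..N}. h j \<noteq> 0 \<and> homogeneous_of_deg (d j) (h j)))"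

lemma cring_poly_ring: "cring (poly_ring l)"
proof -
  let ?C = "{p :: mpoly. \<forall>s \<in> Poly_Mapping.keys p. Poly_Mapping.keys s \<subseteq> {1..l}}"
  have add: "p + q \<in> ?C" if "p \<in> ?C" "q \<in> ?C" for p q
    using that Poly_Mapping.keys_add[of p q] by blast
  have mult: "p * q \<in> ?C" if "p \<in> ?C" "q \<in> ?C" for p q
  proof (clarify)
    fix s v assume s: "s \<in> Poly_Mapping.keys (p * q)" and v: "v \<in> Poly_Mapping.keys s"
    from s obtain a b where ab: "s = a + b" "a \<in> Poly_Mapping.keys p" "b \<in> Poly_Mapping.keys q"
      using Poly_Mapping.keys_mult[of p q] by blast
    then show "v \<in> {1..l}"
      using that v Poly_Mapping.keys_add[of a b] by blast
  qed
  have neg: "\<exists>q \<in> ?C. q + p = 0" if "p \<in> ?C" for p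
    using that by (intro bexI[of _ "- p"]) auto
  have simps: "carrier (poly_ring l) = ?C" "monoid.mult (poly_ring l) = (*)"
      "one (poly_ring l) = 1" "zero (poly_ring l) = 0" "add (poly_ring l) = (+)"
    by (simp_all add: poly_ring_def)
  show ?thesis
  proof (rule cringI)
    show "abelian_group (poly_ring l)"
      by (rule abelian_groupI; unfold simps) (fact add neg | simp add: ac_simps)+
    show "comm_monoid (poly_ring l)"
      by (rule comm_monoidI; unfold simps) (fact mult | simp add: ac_simps)+
  qed (simp add: simps distrib_right)
qed

text \<open>Every polynomial has such a decomposition.\<close>

lemma ex_homogeneous_components: "\<exists>N h. homogeneous_components p N h"
proof -
  define D where "D = total_deg ` Poly_Mapping.keys p"
  define K where "K e = {s \<in> Poly_Mapping.keys p. total_deg s = e}" for e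
  define g :: "nat \<Rightarrow> mpoly"
    where "g e = (\<Sum>s \<in> K e. Poly_Mapping.single s (Poly_Mapping.lookup p s))" for e
  have finK: "finite (K e)" for e by (simp add: K_def)
  have lookup_g: "Poly_Mapping.lookup (g e) s = (if s \<in> K e then Poly_Mapping.lookup p s else 0)" for e s
    by (simp add: g_def lookup_sum lookup_single when_def finK)
  have keys_g: "Poly_Mapping.keys (g e) = K e" for e
    by (auto simp: in_keys_iff lookup_g K_def split: if_splits)
  have finD: "finite D" by (simp add: D_def)
  have sum_g: "(\<Sum>e \<in> D. g e) = p"
  proof (rule poly_mapping_eqI)
    fix s
    have "Poly_Mapping.lookup (\<Sum>e \<in> D. g e) s =
        (\<Sum>e \<in> D. if total_deg s = e then Poly_Mapping.lookup p s else 0)"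
      unfolding lookup_sum lookup_g
      by (intro sum.cong refl) (auto simp: K_def in_keys_iff)
    also have "\<dots> = Poly_Mapping.lookup p s"
      using finD by (auto simp: D_def in_keys_iff)
    finally show "Poly_Mapping.lookup (\<Sum>e \<in> D. g e) s = Poly_Mapping.lookup p s" .
  qed
  have "\<exists>d. bij_betw d {1..card D} D"
    by (rule finite_same_card_bij) (simp_all add: finD)
  then obtain d where d: "bij_betw d {1..card D} D" by blast
  have "p = (\<Sum>j = 1..card D. g (d j))"
    using sum.reindex_bij_betw[OF d, of g] sum_g by simp
  moreover have "g (d j) \<noteq> 0 \<and> homogeneous_of_deg (d j) (g (d j))" if "j \<in> {1..card D}" for j
  proof
    have "d j \<in> D" using d that by (rule bij_betwE[rule_format])
    then have "K (d j) \<noteq> {}" by (auto simp: D_def K_def)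
    then show "g (d j) \<noteq> 0" using keys_g[of "d j"] by auto
    show "homogeneous_of_deg (d j) (g (d j))"
      by (simp add: homogeneous_of_deg_def keys_g K_def)
  qed
  ultimately have "homogeneous_components p (card D) (\<lambda>j. g (d j))"
    unfolding homogeneous_components_def using d by (auto simp: bij_betw_def)
  then show ?thesis by blast
qed

end

theory Submission
  imports Defs
begin

text \<open>
  Suppose that every component \<open>h j\<close> had an \<^emph>\<open>isolated\<close> monomial, one divisible by no monomial of
  another \<open>f k\<close> and by no monomial of another component. The polynomial \<open>f i\<close> has at least two
  components; let \<open>u\<close> and \<open>w\<close> be isolated monomials of two of them, and let \<open>Z\<close> be the ideal of
  all polynomials none of whose monomials divides \<open>u\<close> or \<open>w\<close>.

  Every \<open>f k\<close> with \<open>k \<noteq> i\<close> lies in \<open>Z\<close>. Distinct monomials of the same degree do not divide one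
  another, and \<open>u\<close> and \<open>w\<close> are isolated from the other components, so the only monomials of \<open>f i\<close>
  that divide \<open>u\<close> or \<open>w\<close> are \<open>u\<close> and \<open>w\<close> themselves. Hence
  a product \<open>q * f i\<close> agrees modulo \<open>Z\<close> with \<open>q\<^sub>0 * f i\<close>, where \<open>q\<^sub>0\<close> is the constant term of \<open>q\<close>:
  the vector space spanned by \<open>f i\<close> and \<open>Z\<close> is an ideal (\<open>ideal_scalar_multiples_mod\<close>), and the
  whole ideal \<open>I\<close> is contained in it.

  If \<open>I\<close> is generated by homogeneous polynomials, each such generator \<open>p\<close> is therefore \<open>c * f i\<close>
  modulo \<open>Z\<close> for a scalar \<open>c\<close>. Its coefficients at \<open>u\<close> and \<open>w\<close> are \<open>c\<close> times those of \<open>f i\<close>, which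
  are nonzero; but \<open>u\<close> and \<open>w\<close> have different degrees and cannot both occur in \<open>p\<close>. So \<open>c = 0\<close>
  and \<open>p \<in> Z\<close>. Thus \<open>I \<subseteq> Z\<close>, which is absurd because \<open>f i \<in> I\<close> contains \<open>u\<close>.
\<close>

section \<open>Degrees, monomials and ideals of the polynomial ring\<close>

lemma total_deg_add: "total_deg (s + t) = total_deg s + total_deg t"
proof -
  have ext: "total_deg r = (\<Sum>v \<in> Poly_Mapping.keys s \<union> Poly_Mapping.keys t. Poly_Mapping.lookup r v)"
    if "Poly_Mapping.keys r \<subseteq> Poly_Mapping.keys s \<union> Poly_Mapping.keys t" for r
    unfolding total_deg_def using that
    by (intro sum.mono_neutral_left) (auto simp: in_keys_iff)
  show ?thesis
    using ext[of "s + t"] ext[of s] ext[of t] Poly_Mapping.keys_add[of s t]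
    by (simp add: lookup_add sum.distrib)
qed

lemma total_deg_eq_0_iff: "total_deg s = 0 \<longleftrightarrow> s = 0"
proof
  assume "total_deg s = 0"
  then have "\<forall>v \<in> Poly_Mapping.keys s. Poly_Mapping.lookup s v = 0"
    by (simp add: total_deg_def)
  then show "s = 0"
    by (intro poly_mapping_eqI) (auto simp: in_keys_iff)
qed (simp add: total_deg_def)

lemma poly_ring_simps:
  "p \<in> carrier (poly_ring l) \<longleftrightarrow> (\<forall>s \<in> Poly_Mapping.keys p. Poly_Mapping.keys s \<subseteq> {1..l})"
  "p \<otimes>\<^bsub>poly_ring l\<^esub> q = p * q" "p \<oplus>\<^bsub>poly_ring l\<^esub> q = p + q"
  "\<zero>\<^bsub>poly_ring l\<^esub> = 0" "\<one>\<^bsub>poly_ring l\<^esub> = 1"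
  by (simp_all add: poly_ring_def)

lemma poly_ring_closed:
  assumes "p \<in> carrier (poly_ring l)" "q \<in> carrier (poly_ring l)"
  shows "p + q \<in> carrier (poly_ring l)" "p * q \<in> carrier (poly_ring l)"
proof -
  interpret cring "poly_ring l" by (rule cring_poly_ring)
  show "p + q \<in> carrier (poly_ring l)" "p * q \<in> carrier (poly_ring l)"
    using a_closed[OF assms] m_closed[OF assms] by (simp_all only: poly_ring_simps(2,3))
qed

lemma poly_ring_idealI:
  assumes sub: "J \<subseteq> carrier (poly_ring l)" and zero: "0 \<in> J"
    and add: "\<And>p q. p \<in> J \<Longrightarrow> q \<in> J \<Longrightarrow> p + q \<in> J"
    and mult: "\<And>q p. q \<in> carrier (poly_ring l) \<Longrightarrow> p \<in> J \<Longrightarrow> q * p \<in> J"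
  shows "ideal J (poly_ring l)"
proof -
  interpret cring "poly_ring l" by (rule cring_poly_ring)
  show ?thesis
  proof (rule idealI)
    show "subgroup J (add_monoid (poly_ring l))"
    proof (rule add.subgroupI)
      fix p assume p: "p \<in> J"
      then have "\<ominus>\<^bsub>poly_ring l\<^esub> p = (\<ominus>\<^bsub>poly_ring l\<^esub> \<one>\<^bsub>poly_ring l\<^esub>) * p"
        using l_minus[OF one_closed, of p] l_one[of p] sub by (auto simp only: poly_ring_simps(2))
      then show "\<ominus>\<^bsub>poly_ring l\<^esub> p \<in> J"
        using mult p by simp
    qed (use sub zero add in \<open>auto simp: poly_ring_simps(3)\<close>)
    show "p \<otimes>\<^bsub>poly_ring l\<^esub> q \<in> J" if "p \<in> J" "q \<in> carrier (poly_ring l)" for p q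
      using mult[OF that(2,1)] by (simp add: poly_ring_simps(2) mult.commute)
  qed (use mult in \<open>auto simp: poly_ring_simps(2) ring_axioms\<close>)
qed

text \<open>If \<open>s + t\<close> is an exponent vector in the variables of the ring, then so is \<open>t\<close>, since exponents
  cannot cancel; the cofactor is thus a monomial of the ring.\<close>

lemma single_divides_single:
  assumes "Poly_Mapping.keys (s + t) \<subseteq> {1..l}"
  shows "Poly_Mapping.single s 1 divides\<^bsub>poly_ring l\<^esub> Poly_Mapping.single (s + t) 1"
proof (rule dividesI)
  have "Poly_Mapping.keys t \<subseteq> Poly_Mapping.keys (s + t)"
    by (auto simp: in_keys_iff lookup_add)
  then show "Poly_Mapping.single t 1 \<in> carrier (poly_ring l)"
    using assms by (auto simp: poly_ring_simps(1))
  show "Poly_Mapping.single (s + t) 1 =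
      Poly_Mapping.single s 1 \<otimes>\<^bsub>poly_ring l\<^esub> Poly_Mapping.single t 1"
    by (simp add: poly_ring_simps(2) mult_single)
qed

section \<open>Homogeneous components\<close>

text \<open>The graded pieces have distinct degrees, so their monomials do not cancel in the sum.\<close>

lemma keys_homogeneous_components:
  assumes "homogeneous_components p N h"
  shows "Poly_Mapping.keys p = (\<Union>j \<in> {1..N}. Poly_Mapping.keys (h j))"
proof
  from assms obtain d where p: "p = (\<Sum>j = 1..N. h j)" and d: "inj_on d {1..N}"
      "\<And>j. j \<in> {1..N} \<Longrightarrow> homogeneous_of_deg (d j) (h j)"
    unfolding homogeneous_components_def by blast
  show "Poly_Mapping.keys p \<subseteq> (\<Union>j \<in> {1..N}. Poly_Mapping.keys (h j))"
    unfolding p by (rule Poly_Mapping.keys_sum)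
  show "(\<Union>j \<in> {1..N}. Poly_Mapping.keys (h j)) \<subseteq> Poly_Mapping.keys p"
  proof clarify
    fix j s assume j: "j \<in> {1..N}" and s: "s \<in> Poly_Mapping.keys (h j)"
    have "Poly_Mapping.lookup (h k) s = 0" if "k \<in> {1..N} - {j}" for k
    proof -
      have "d k \<noteq> d j" using inj_onD[OF d(1), of k j] j that by blast
      then have "s \<notin> Poly_Mapping.keys (h k)"
        using d(2)[of k] d(2)[of j] j s that by (auto simp: homogeneous_of_deg_def)
      then show ?thesis by (simp add: in_keys_iff)
    qed
    then have "Poly_Mapping.lookup p s = Poly_Mapping.lookup (h j) s"
      using sum.remove[OF _ j, of "\<lambda>k. Poly_Mapping.lookup (h k) s"] by (simp add: p lookup_sum)
    then show "s \<in> Poly_Mapping.keys p"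
      using s by (simp add: in_keys_iff)
  qed
qed

lemma two_le_homogeneous_components:
  assumes "homogeneous_components p N h" "\<not> homogeneous p"
  shows "2 \<le> N"
proof (rule ccontr)
  assume "\<not> 2 \<le> N"
  then consider "N = 0" | "N = 1" by linarith
  then have "homogeneous p"
    using assms(1)
    by cases (auto simp: homogeneous_components_def homogeneous_def homogeneous_of_deg_def)
  with assms(2) show False ..
qed

section \<open>Ideals defined by the monomials that divide a given one\<close>

text \<open>In exponent vectors, \<open>s\<close> divides \<open>u\<close> iff \<open>u = s + t\<close> for some \<open>t\<close>. The set below is an ideal
  because a monomial of a multiple of \<open>p\<close> is a multiple of a monomial of \<open>p\<close>.\<close>

definition no_monomial_dividing :: "nat \<Rightarrow> (nat \<Rightarrow>\<^sub>0 nat) set \<Rightarrow> mpoly set" where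
  "no_monomial_dividing l A =
     {p \<in> carrier (poly_ring l). \<forall>s \<in> Poly_Mapping.keys p. \<forall>t. s + t \<notin> A}"

lemma ideal_no_monomial_dividing: "ideal (no_monomial_dividing l A) (poly_ring l)"
proof (rule poly_ring_idealI)
  show "no_monomial_dividing l A \<subseteq> carrier (poly_ring l)" "0 \<in> no_monomial_dividing l A"
    by (auto simp: no_monomial_dividing_def poly_ring_simps(1))
  show "p + q \<in> no_monomial_dividing l A"
    if "p \<in> no_monomial_dividing l A" "q \<in> no_monomial_dividing l A" for p q
    using that Poly_Mapping.keys_add[of p q]
    by (auto simp: no_monomial_dividing_def poly_ring_closed)
  show "q * p \<in> no_monomial_dividing l A"
    if q: "q \<in> carrier (poly_ring l)" and p: "p \<in> no_monomial_dividing l A" for q p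
  proof -
    have "s + t \<notin> A" if s: "s \<in> Poly_Mapping.keys (q * p)" for s t
    proof -
      obtain a b where "s = a + b" "b \<in> Poly_Mapping.keys p"
        using s Poly_Mapping.keys_mult[of q p] by blast
      moreover have "a + b + t = b + (a + t)" by (simp add: ac_simps)
      ultimately show ?thesis using p by (auto simp: no_monomial_dividing_def)
    qed
    then show ?thesis
      using p q by (auto simp: no_monomial_dividing_def poly_ring_closed)
  qed
qed

text \<open>If a monomial of \<open>f\<close> divides an element of \<open>A\<close> only by being equal to it, then \<open>q * f\<close> and
  \<open>q\<^sub>0 * f\<close>, with \<open>q\<^sub>0\<close> the constant term of \<open>q\<close>, differ by an element of
  \<open>no_monomial_dividing l A\<close>: the monomials of \<open>(q - q\<^sub>0) * f\<close> are proper multiples of monomials of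
  \<open>f\<close>. So the scalar multiples of \<open>f\<close> suffice to form an ideal modulo \<open>no_monomial_dividing l A\<close>.\<close>

lemma ideal_scalar_multiples_mod:
  assumes f: "f \<in> carrier (poly_ring l)"
    and min: "\<And>s t. s \<in> Poly_Mapping.keys f \<Longrightarrow> s + t \<in> A \<Longrightarrow> t = 0"
  shows "ideal {p \<in> carrier (poly_ring l).
           \<exists>c. p - Poly_Mapping.single 0 c * f \<in> no_monomial_dividing l A} (poly_ring l)"
    (is "ideal ?J _")
proof (rule poly_ring_idealI)
  let ?Z = "no_monomial_dividing l A"
  interpret Z: ideal ?Z "poly_ring l" by (rule ideal_no_monomial_dividing)
  have Z_add: "x + y \<in> ?Z" if "x \<in> ?Z" "y \<in> ?Z" for x y
    using additive_subgroup.a_closed[OF Z.is_additive_subgroup that] by (simp add: poly_ring_simps(3))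
  have Z_mult: "q * x \<in> ?Z" if "x \<in> ?Z" "q \<in> carrier (poly_ring l)" for q x
    using Z.I_l_closed[OF that] by (simp add: poly_ring_simps(2))
  show "?J \<subseteq> carrier (poly_ring l)" by blast
  show "0 \<in> ?J"
    by (auto simp: no_monomial_dividing_def poly_ring_simps(1) intro!: exI[of _ 0])
  show "p + q \<in> ?J" if p: "p \<in> ?J" and q: "q \<in> ?J" for p q
  proof -
    obtain a b where "p - Poly_Mapping.single 0 a * f \<in> ?Z" "q - Poly_Mapping.single 0 b * f \<in> ?Z"
      using p q by blast
    from Z_add[OF this] have "p + q - Poly_Mapping.single 0 (a + b) * f \<in> ?Z"
      by (simp add: single_add algebra_simps)
    then show ?thesis using p q by (auto simp: poly_ring_closed)
  qed
  show "q * p \<in> ?J" if q: "q \<in> carrier (poly_ring l)" and p: "p \<in> ?J" for q p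
  proof -
    obtain c where c: "p - Poly_Mapping.single 0 c * f \<in> ?Z" using p by blast
    define e where "e = Poly_Mapping.lookup q 0"
    define r where "r = q - Poly_Mapping.single 0 e"
    have keys_r: "Poly_Mapping.keys r \<subseteq> Poly_Mapping.keys q - {0}"
      by (auto simp: r_def e_def in_keys_iff lookup_minus lookup_single when_def
          split: if_splits)
    have r: "r \<in> carrier (poly_ring l)"
      using q keys_r by (auto simp: poly_ring_simps(1))
    have "r * f \<in> ?Z"
    proof -
      have "s + t \<notin> A" if "s \<in> Poly_Mapping.keys (r * f)" for s t
      proof
        assume "s + t \<in> A"
        moreover obtain a b where "s = a + b" and a: "a \<in> Poly_Mapping.keys r"
            and b: "b \<in> Poly_Mapping.keys f"
          using \<open>s \<in> Poly_Mapping.keys (r * f)\<close> Poly_Mapping.keys_mult[of r f] by blast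
        ultimately have "b + (a + t) \<in> A" by (simp add: ac_simps)
        then have "a + t = 0" using min b by blast
        then have "total_deg a + total_deg t = 0"
          by (simp add: total_deg_eq_0_iff flip: total_deg_add)
        then have "a = 0" by (simp add: total_deg_eq_0_iff)
        then show False using a keys_r by blast
      qed
      then show ?thesis
        using poly_ring_closed(2)[OF r f] unfolding no_monomial_dividing_def by blast
    qed
    moreover have "Poly_Mapping.single 0 c \<in> carrier (poly_ring l)"
      by (simp add: poly_ring_simps(1))
    ultimately have "q * (p - Poly_Mapping.single 0 c * f) + Poly_Mapping.single 0 c * (r * f) \<in> ?Z"
      by (rule Z_add[OF Z_mult[OF c q] Z_mult])
    moreover have "q * (p - Poly_Mapping.single 0 c * f) + Poly_Mapping.single 0 c * (r * f)
        = q * p - Poly_Mapping.single 0 c * Poly_Mapping.single 0 e * f"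
      by (simp add: r_def algebra_simps)
    ultimately have "q * p - Poly_Mapping.single 0 (c * e) * f \<in> ?Z"
      by (simp add: mult_single)
    then show ?thesis using p q by (auto simp: poly_ring_closed)
  qed
qed

section \<open>Monomials of components of generators of a homogeneous ideal\<close>

theorem lemma5p0p1:
  fixes l m n i N :: nat
    and f h :: "nat \<Rightarrow> mpoly"
  assumes "\<forall>k \<in> {1..n}. f k \<in> carrier (poly_ring l)"
    and "m \<le> n"
    and "card {k \<in> {1..n}. \<not> homogeneous (f k)} = m"
    and "i \<in> {1..n}"
    and "\<not> homogeneous (f i)"
    and "homogeneous_components (f i) N h"
    and "homogeneous_ideal l (Idl\<^bsub>poly_ring l\<^esub> (f ` {1..n}))"
  shows "\<exists>j \<in> {1..N}. \<forall>u \<in> monomials (h j).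
           (\<exists>k \<in> {1..n} - {i}. \<exists>v \<in> monomials (f k). v divides\<^bsub>poly_ring l\<^esub> u) \<or>
           (\<exists>k \<in> {1..N} - {j}. \<exists>v \<in> monomials (h k). v divides\<^bsub>poly_ring l\<^esub> u)"
proof (rule ccontr)
  assume "\<not> ?thesis"
  then have contra: "\<forall>j \<in> {1..N}. \<exists>x \<in> monomials (h j). \<not>
      ((\<exists>k \<in> {1..n} - {i}. \<exists>v \<in> monomials (f k). v divides\<^bsub>poly_ring l\<^esub> x) \<or>
       (\<exists>k \<in> {1..N} - {j}. \<exists>v \<in> monomials (h k). v divides\<^bsub>poly_ring l\<^esub> x))"
    by (simp only: bex_simps(8) ball_simps(10) not_not)
  interpret R: cring "poly_ring l" by (rule cring_poly_ring)
  let ?I = "Idl\<^bsub>poly_ring l\<^esub> (f ` {1..n})"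
  note comps = assms(6) and keys_f = keys_homogeneous_components[OF assms(6)]
  have f_carrier: "f ` {1..n} \<subseteq> carrier (poly_ring l)" using assms(1) by blast
  have fi_carrier: "f i \<in> carrier (poly_ring l)" using assms(1,4) by blast
  obtain d where d: "inj_on d {1..N}" "\<And>j. j \<in> {1..N} \<Longrightarrow> homogeneous_of_deg (d j) (h j)"
    using comps unfolding homogeneous_components_def by blast
  have deg: "total_deg s = d j" if "j \<in> {1..N}" "s \<in> Poly_Mapping.keys (h j)" for s j
    using d(2) that by (auto simp: homogeneous_of_deg_def)

  have isolated: "\<exists>u \<in> Poly_Mapping.keys (h j).
      (\<forall>k \<in> {1..n} - {i}. \<forall>s \<in> Poly_Mapping.keys (f k). \<forall>t. s + t \<noteq> u) \<and>
      (\<forall>s \<in> Poly_Mapping.keys (f i). \<forall>t. s + t = u \<longrightarrow> t = 0)" if j: "j \<in> {1..N}" for j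
  proof -
    from bspec[OF contra j] obtain x where x: "x \<in> monomials (h j)" and nx: "\<not>
      ((\<exists>k \<in> {1..n} - {i}. \<exists>v \<in> monomials (f k). v divides\<^bsub>poly_ring l\<^esub> x) \<or>
       (\<exists>k \<in> {1..N} - {j}. \<exists>v \<in> monomials (h k). v divides\<^bsub>poly_ring l\<^esub> x))"
      by (rule bexE)
    from x obtain u where u: "u \<in> Poly_Mapping.keys (h j)" and xu: "x = Poly_Mapping.single u 1"
      unfolding monomials_def by blast
    have nf: "\<And>k s. k \<in> {1..n} - {i} \<Longrightarrow> s \<in> Poly_Mapping.keys (f k) \<Longrightarrow>
        \<not> Poly_Mapping.single s 1 divides\<^bsub>poly_ring l\<^esub> Poly_Mapping.single u 1"
      using nx unfolding xu monomials_def by blast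
    have nh: "\<And>k s. k \<in> {1..N} - {j} \<Longrightarrow> s \<in> Poly_Mapping.keys (h k) \<Longrightarrow>
        \<not> Poly_Mapping.single s 1 divides\<^bsub>poly_ring l\<^esub> Poly_Mapping.single u 1"
      using nx unfolding xu monomials_def by blast
    have "u \<in> Poly_Mapping.keys (f i)" using keys_f u j by blast
    then have "Poly_Mapping.keys u \<subseteq> {1..l}"
      using fi_carrier by (simp add: poly_ring_simps(1))
    then have dvd: "Poly_Mapping.single s 1 divides\<^bsub>poly_ring l\<^esub> Poly_Mapping.single u 1"
      if "s + t = u" for s t
      using single_divides_single that by blast
    have "t = 0" if s: "s \<in> Poly_Mapping.keys (f i)" and st: "s + t = u" for s t
    proof -
      obtain k where k: "k \<in> {1..N}" "s \<in> Poly_Mapping.keys (h k)" using s keys_f by blast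
      then have "k = j" using nh dvd[OF st] by blast
      then have "total_deg s = total_deg u" using deg k u by metis
      then show "t = 0" using total_deg_add[of s t] st by (simp add: total_deg_eq_0_iff)
    qed
    moreover have "s + t \<noteq> u"
      if "k \<in> {1..n} - {i}" "s \<in> Poly_Mapping.keys (f k)" for k s t
      using nf[OF that] dvd by blast
    ultimately show ?thesis using u by blast
  qed

  have "2 \<le> N" using two_le_homogeneous_components comps assms(5) .
  then have N: "1 \<in> {1..N}" "2 \<in> {1..N}" by auto
  obtain u where u: "u \<in> Poly_Mapping.keys (h 1)"
      "\<forall>k \<in> {1..n} - {i}. \<forall>s \<in> Poly_Mapping.keys (f k). \<forall>t. s + t \<noteq> u"
      "\<forall>s \<in> Poly_Mapping.keys (f i). \<forall>t. s + t = u \<longrightarrow> t = 0"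
    using isolated[OF N(1)] by (elim bexE conjE) (rule that)
  obtain w where w: "w \<in> Poly_Mapping.keys (h 2)"
      "\<forall>k \<in> {1..n} - {i}. \<forall>s \<in> Poly_Mapping.keys (f k). \<forall>t. s + t \<noteq> w"
      "\<forall>s \<in> Poly_Mapping.keys (f i). \<forall>t. s + t = w \<longrightarrow> t = 0"
    using isolated[OF N(2)] by (elim bexE conjE) (rule that)
  have deg_neq: "total_deg u \<noteq> total_deg w"
    using deg[OF N(1) u(1)] deg[OF N(2) w(1)] inj_onD[OF d(1) _ N] by auto
  have uw_f: "u \<in> Poly_Mapping.keys (f i)" "w \<in> Poly_Mapping.keys (f i)"
    using u(1) w(1) N keys_f by blast+

  let ?Z = "no_monomial_dividing l {u, w}"
  let ?J = "{p \<in> carrier (poly_ring l). \<exists>c. p - Poly_Mapping.single 0 c * f i \<in> ?Z}"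
  have uw_Z: "u \<notin> Poly_Mapping.keys p" "w \<notin> Poly_Mapping.keys p" if "p \<in> ?Z" for p
  proof -
    have "s \<notin> {u, w}" if "s \<in> Poly_Mapping.keys p" for s
    proof -
      have "s + 0 \<notin> {u, w}"
        using \<open>p \<in> ?Z\<close> that unfolding no_monomial_dividing_def by blast
      then show ?thesis by simp
    qed
    then show "u \<notin> Poly_Mapping.keys p" "w \<notin> Poly_Mapping.keys p" by blast+
  qed
  have "f k \<in> ?J" if k: "k \<in> {1..n}" for k
  proof (cases "k = i")
    case True
    have "f i - Poly_Mapping.single 0 1 * f i \<in> ?Z"
      by (simp add: no_monomial_dividing_def poly_ring_simps(1))
    then show ?thesis using True fi_carrier by blast
  next
    case False
    then have "f k - Poly_Mapping.single 0 0 * f i \<in> ?Z"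
      using bspec[OF u(2), of k] bspec[OF w(2), of k] k assms(1)
      by (simp add: no_monomial_dividing_def)
    then show ?thesis using k assms(1) by blast
  qed
  moreover have "ideal ?J (poly_ring l)"
    using u(3) w(3) fi_carrier by (intro ideal_scalar_multiples_mod) auto
  ultimately have I_J: "?I \<subseteq> ?J"
    by (intro R.genideal_minimal) auto

  obtain S where S: "S \<subseteq> carrier (poly_ring l)" "\<forall>p \<in> S. homogeneous p"
      "?I = Idl\<^bsub>poly_ring l\<^esub> S"
    using assms(7) unfolding homogeneous_ideal_def by blast
  \<comment> \<open>A homogeneous generator cannot contain both \<open>u\<close> and \<open>w\<close>, which forces its scalar to be 0.\<close>
  have "S \<subseteq> ?Z"
  proof
    fix p assume p: "p \<in> S"
    then have "p \<in> ?I" using R.genideal_self[OF S(1)] S(3) by blast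
    then obtain c where c: "p - Poly_Mapping.single 0 c * f i \<in> ?Z" using I_J by blast
    have lookup_scalar: "Poly_Mapping.lookup (Poly_Mapping.single 0 c * q) s = c * Poly_Mapping.lookup q s"
      for q :: mpoly and s
      by (simp add: map.rep_eq when_def flip: mult_map_scale_conv_mult)
    have "Poly_Mapping.lookup p u = c * Poly_Mapping.lookup (f i) u"
         "Poly_Mapping.lookup p w = c * Poly_Mapping.lookup (f i) w"
      using uw_Z[OF c] by (simp_all add: in_keys_iff lookup_minus lookup_scalar)
    then have "c = 0 \<or> u \<in> Poly_Mapping.keys p \<and> w \<in> Poly_Mapping.keys p"
      using uw_f by (auto simp: in_keys_iff)
    moreover obtain e where "\<forall>s \<in> Poly_Mapping.keys p. total_deg s = e"
      using S(2) p unfolding homogeneous_def homogeneous_of_deg_def by blast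
    ultimately have "c = 0" using deg_neq by auto
    then show "p \<in> ?Z" using c by simp
  qed
  then have "?I \<subseteq> ?Z"
    unfolding S(3) by (rule R.genideal_minimal[OF ideal_no_monomial_dividing])
  moreover have "f i \<in> ?I"
    using R.genideal_self[OF f_carrier] assms(4) by blast
  ultimately have "f i \<in> ?Z" by (rule subsetD)
  then show False using uw_Z(1) uw_f(1) by blast
qed

end
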